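(* Let $u\in\{\mathrm{r},\mathrm{t}\}$, let $\bar u$ be the other element of $\{\mathrm{r},\mathrm{t}\}$, and let $g_{\mathrm{fas},u}=\max\{g_u^1,\dots,g_u^{N_u}\}$, where the $g_u^n$ are Gamma distributed with parameters $m$ and $\overline g_u$ and are coupled by the Student-$t$ copula with $\nu_u>0$ degrees of freedom and correlation matrix $\mathbf{\Sigma}_u$. For $\overline\gamma>0$ let $$\gamma_{\mathrm{c},u} = \frac{\overline{\gamma}\alpha_\mathrm{c}L_uK^2g_{\mathrm{fas},u}}{\overline{\gamma}(\alpha_{\mathrm{p,r}}+\alpha_{\mathrm{p,t}})L_uK^2g_{\mathrm{fas},u}+1},\qquad \gamma_{\mathrm{p},u} = \frac{\overline{\gamma}\alpha_{\mathrm{p},u}L_uK^2g_{\mathrm{fas},u}}{\overline{\gamma}\alpha_{\mathrm{p},\bar{u}}L_uK^2g_{\mathrm{fas},u}+1}.$$ Let $\gamma_{\mathrm{th,c}}^u,\gamma_{\mathrm{th,p}}^u>0$ be fixed thresholds with $\gamma_{\mathrm{th,c}}^u<\frac{\alpha_\mathrm{c}}{1-\alpha_\mathrm{c}}$ and $\gamma_{\mathrm{th,p}}^u<\frac{\alpha_{\mathrm{p},u}}{1-\alpha_\mathrm{c}-\alpha_{\mathrm{p},u}}$, and let $P_{\mathrm{o},u}=1-\Pr\left(\gamma_{\mathrm{c},u}>\gamma_{\mathrm{th,c}}^u,\ \gamma_{\mathrm{p},u}>\gamma_{\mathrm{th,p}}^u\right)$ be the outage probability. Set $\gamma_{\mathrm{th}}^u=\max\{\hat{\gamma}_\mathrm{th,c}^u,\hat{\gamma}_\mathrm{th,p}^u\}$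 with $$\hat{\gamma}_\mathrm{th,c}^u = \frac{\gamma_{\mathrm{th,c}}^u}{\overline{\gamma}L_uK^2\left(\alpha_\mathrm{c}-(\alpha_\mathrm{p,r}+\alpha_\mathrm{p,t})\gamma_\mathrm{th,c}^u\right)},\qquad \hat{\gamma}_\mathrm{th,p}^u = \frac{\gamma_{\mathrm{th,p}}^u}{\overline{\gamma}L_uK^2\left(\alpha_{\mathrm{p},u}-\alpha_{\mathrm{p},\bar{u}}\gamma_\mathrm{th,p}^u\right)}.$$ Then, as $\overline\gamma\to\infty$ with all other parameters fixed, $P_{\mathrm{o},u}$ is asymptotically equivalent (ratio tending to $1$) to $$P_{\mathrm{o},u}^\infty = T_{\nu_u,\mathbf{\Sigma}_u}\left(t_{\nu_u}^{-1}\left(\frac{1}{m\Gamma(m)}\left(\frac{m\gamma_{\mathrm{th}}^u}{\overline{g}_u}\right)^m\right),\dots,t_{\nu_u}^{-1}\left(\frac{1}{m\Gamma(m)}\left(\frac{m\gamma_{\mathrm{th}}^u}{\overline{g}_u}\right)^m\right)\right)$$ (with $N_u$ identical arguments; this is defined for all sufficiently large $\overline\gamma$).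
   Context: Marginals. Each port gain $g_u^{n}$, $n=1,\dots,N_u$ ($N_u\ge1$), has, for $g>0$, PDF $\frac{m^m}{\Gamma(m)\overline{g}_u^m} g^{m-1}\exp(-mg/\overline{g}_u)$ and CDF $\frac{1}{\Gamma(m)}\Upsilon(m,mg/\overline{g}_u)$, where $\Gamma$ is the Gamma function and $\Upsilon(s,x)=\int_0^x z^{s-1}e^{-z}\,dz$ is the lower incomplete Gamma function. Parameters. $\overline g_u=\beta_u^2\varphi_1^2\tilde a^4$ and $m=\frac{K}{2}\cdot\frac{\varphi_1^2\tilde a^4}{1+\varphi_2-2\varphi_1^2\tilde a^4}$. Here $K\ge1$ is the number of surface (STAR-RIS) elements; $\beta_u\in(0,1]$ is the amplitude coefficient towards user $u$; $\varphi_p=\mathbb{E}[e^{jp\Theta}]=\mathcal I_p(\kappa)/\mathcal I_0(\kappa)$ are the circular moments of a zero-mean von Mises phase error $\Theta$ with concentration $\kappa>0$ ($\mathcal I_p$ is the modified Bessel function of the first kind); $\tilde a=\sqrt{a_{\mathrm b}a_u}$, where $a_{\mathrm b},a_u\in(0,1]$ are the mean magnitudes of the unit-power fading coefficients from the base station to a surface element and from a surface element to user $u$. Thus $m>0$ and $\overline g_u>0$. Dependence. $\mathbf{\Sigma}_u$ is an $N_u\times N_u$ positive definite correlation matrix. $t_\nu^{-1}$ is the quantile function of the univariate Student-$t$ distribution with $\nu$ degrees of freedom. $T_{\nu,\mathbf{\Sigma}}$ is the joint CDF of the centred multivariate Student-$t$ distribution with $\nu$ degrees of freedom and correlation (scale)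 matrix $\mathbf{\Sigma}$. The Student-$t$ copula is $C(v_1,\dots,v_d)=T_{\nu,\mathbf{\Sigma}}(t_\nu^{-1}(v_1),\dots,t_\nu^{-1}(v_d))$. That $(g_u^1,\dots,g_u^{N_u})$ has this copula means that its joint CDF is $C(F_{g_u^1}(x_1),\dots,F_{g_u^{N_u}}(x_{N_u}))$, where $F_{g_u^n}$ is the CDF of $g_u^n$. Signalling. $\overline\gamma>0$ is the average transmit SNR and $L_u>0$ is the path loss. $\alpha_\mathrm{c},\alpha_{\mathrm{p,r}},\alpha_{\mathrm{p,t}}>0$ are the power allocation factors, with $\alpha_\mathrm{c}+\alpha_{\mathrm{p,r}}+\alpha_{\mathrm{p,t}}=1$. *)

theory Defs
  imports "HOL-Probability.Probability"
begin

definition bessel_I :: "nat \<Rightarrow> real \<Rightarrow> real" where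
  "bessel_I p x = (\<Sum>k. (x / 2) ^ (2 * k + p) / (fact k * fact (k + p)))"

definition von_mises :: "real \<Rightarrow> real measure" where
  "von_mises \<kappa> = density lborel
     (\<lambda>\<theta>. ennreal (indicator {-pi..pi} \<theta> * (exp (\<kappa> * cos \<theta>) / (2 * pi * bessel_I 0 \<kappa>))))"

text \<open>The ratio is the expectation of \<open>cis (p * \<theta>)\<close>: see \<open>von_mises_moment\<close> below.\<close>

definition circular_moment :: "nat \<Rightarrow> real \<Rightarrow> real" where
  "circular_moment p \<kappa> = bessel_I p \<kappa> / bessel_I 0 \<kappa>"

lemma bessel_I_summable: "summable (\<lambda>k. (x / 2) ^ (2 * k + p) / (fact k * fact (k + p)) :: real)"
proof (rule summable_comparison_test')
  show "summable (\<lambda>k. \<bar>x / 2\<bar> ^ p * (inverse (fact k) * (\<bar>x / 2\<bar>\<^sup>2) ^ k))"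
    by (intro summable_mult summable_exp)
  fix k :: nat
  have "fact k * 1 \<le> (fact k * fact (k + p) :: real)"
    by (intro mult_left_mono) auto
  then have "\<bar>x / 2\<bar> ^ (2 * k + p) / (fact k * fact (k + p)) \<le> \<bar>x / 2\<bar> ^ (2 * k + p) / fact k"
    by (intro divide_left_mono) auto
  also have "\<dots> = \<bar>x / 2\<bar> ^ p * (inverse (fact k) * (\<bar>x / 2\<bar>\<^sup>2) ^ k)"
    by (simp only: power_add power_mult) (simp add: field_simps)
  finally show "norm ((x / 2) ^ (2 * k + p) / (fact k * fact (k + p)))
      \<le> \<bar>x / 2\<bar> ^ p * (inverse (fact k) * (\<bar>x / 2\<bar>\<^sup>2) ^ k)"
    by (simp only: real_norm_def abs_divide power_abs abs_mult abs_of_nonneg fact_ge_zero)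
qed

lemma bessel_I_0_pos: "0 < bessel_I 0 x"
  unfolding bessel_I_def
proof (rule suminf_pos2)
  show "summable (\<lambda>k. (x / 2) ^ (2 * k + 0) / (fact k * fact (k + 0)))"
    by (rule bessel_I_summable)
  show "0 \<le> (x / 2) ^ (2 * n + 0) / (fact n * fact (n + 0))" for n
    by (simp add: power_mult)
  show "0 < (x / 2) ^ (2 * 0 + 0) / (fact 0 * fact (0 + 0))" by simp
qed

lemma integral_cis:
  "(LINT \<theta>:{-pi..pi}|lborel. cis (of_int k * \<theta>)) = (if k = 0 then 2 * of_real pi else 0)"
proof (cases "k = 0")
  case True
  then show ?thesis by (simp add: set_lebesgue_integral_def scaleR_conv_of_real)
next
  case False
  have "((\<lambda>\<theta>. cis (of_int k * \<theta>)) has_integral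
      (cis (of_int k * pi) / (\<i> * of_int k) - cis (of_int k * (-pi)) / (\<i> * of_int k))) {-pi..pi}"
  proof (rule fundamental_theorem_of_calculus)
    fix \<theta> :: real
    have "((\<lambda>z. exp (\<i> * of_int k * z) / (\<i> * of_int k)) has_field_derivative
        exp (\<i> * of_int k * of_real \<theta>)) (at (of_real \<theta>))"
      using False by (auto intro!: derivative_eq_intros)
    from has_vector_derivative_real_field[OF this]
    show "((\<lambda>\<theta>. cis (of_int k * \<theta>) / (\<i> * of_int k)) has_vector_derivative
        cis (of_int k * \<theta>)) (at \<theta> within {-pi..pi})"
      by (simp add: cis_conv_exp mult.assoc)
  qed simp
  moreover have "cis (of_int k * pi) = cis (of_int k * (-pi))"
    using sin_zero_iff_int2[of "of_int k * pi"] by (auto simp: complex_eq_iff)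
  ultimately have "((\<lambda>\<theta>. cis (of_int k * \<theta>)) has_integral 0) {-pi..pi}" by simp
  moreover have "set_integrable lborel {-pi..pi} (\<lambda>\<theta>. cis (of_int k * \<theta>))"
    by (intro borel_integrable_atLeastAtMost') (auto intro!: continuous_intros)
  ultimately show ?thesis using False
    by (simp add: set_borel_integral_eq_integral(2) integral_unique)
qed

lemma integral_cos_power_cis:
  "(LINT \<theta>:{-pi..pi}|lborel. of_real (cos \<theta> ^ n) * cis (real p * \<theta>)) =
     (if \<exists>k. n = 2 * k + p then of_real (2 * pi / 2 ^ n * real (n choose ((n + p) div 2))) else 0)"
proof -
  have expand: "of_real (cos \<theta> ^ n) * cis (real p * \<theta>) =
      (\<Sum>j\<le>n. of_real (real (n choose j) / 2 ^ n) * cis (of_int (int n + int p - 2 * int j) * \<theta>))"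
    for \<theta>
  proof -
    have "of_real (cos \<theta> ^ n) = ((cis (-\<theta>) + cis \<theta>) / 2) ^ n"
      by (simp add: complex_eq_iff flip: of_real_power)
    also have "\<dots> = (\<Sum>j\<le>n. of_nat (n choose j) * cis (-\<theta>) ^ j * cis \<theta> ^ (n - j)) / 2 ^ n"
      by (simp add: power_divide binomial_ring)
    also have "\<dots> * cis (real p * \<theta>) =
        (\<Sum>j\<le>n. of_real (real (n choose j) / 2 ^ n) * cis (of_int (int n + int p - 2 * int j) * \<theta>))"
      unfolding sum_divide_distrib sum_distrib_right
    proof (rule sum.cong)
      fix j assume "j \<in> {..n}"
      then have "real j * - \<theta> + real (n - j) * \<theta> + real p * \<theta>
          = of_int (int n + int p - 2 * int j) * \<theta>"
        by (simp add: of_nat_diff algebra_simps)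
      then have "cis (-\<theta>) ^ j * cis \<theta> ^ (n - j) * cis (real p * \<theta>)
          = cis (of_int (int n + int p - 2 * int j) * \<theta>)"
        unfolding Complex.DeMoivre cis_mult by (rule arg_cong)
      then show "of_nat (n choose j) * cis (-\<theta>) ^ j * cis \<theta> ^ (n - j) / 2 ^ n * cis (real p * \<theta>)
          = of_real (real (n choose j) / 2 ^ n) * cis (of_int (int n + int p - 2 * int j) * \<theta>)"
        by (simp add: field_simps)
    qed simp
    finally show ?thesis .
  qed
  have int: "set_integrable lborel {-pi..pi} (\<lambda>\<theta>. c * cis (of_int k * \<theta>))" for c k
    by (intro borel_integrable_atLeastAtMost') (auto intro!: continuous_intros)
  have "(LINT \<theta>:{-pi..pi}|lborel. of_real (cos \<theta> ^ n) * cis (real p * \<theta>)) =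
      (\<Sum>j\<le>n. of_real (real (n choose j) / 2 ^ n) *
        (LINT \<theta>:{-pi..pi}|lborel. cis (of_int (int n + int p - 2 * int j) * \<theta>)))"
    using int unfolding expand set_lebesgue_integral_def set_integrable_def scaleR_sum_right
    by (subst Bochner_Integration.integral_sum) (simp_all only: mult_scaleR_right[symmetric] integral_mult_right_zero)
  also have "\<dots> = (\<Sum>j\<le>n. if n + p = 2 * j then of_real (2 * pi / 2 ^ n * real (n choose j)) else 0)"
    unfolding integral_cis by (intro sum.cong) (auto simp: field_simps)
  also have "\<dots> = (if \<exists>k. n = 2 * k + p
      then of_real (2 * pi / 2 ^ n * real (n choose ((n + p) div 2))) else 0)"
  proof (cases "\<exists>k. n = 2 * k + p")
    case True
    then obtain k where k: "n = 2 * k + p" by blast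
    then have "n + p = 2 * j \<longleftrightarrow> j = k + p" for j by auto
    moreover have "(n + p) div 2 = k + p" "k + p \<le> n" using k by auto
    ultimately show ?thesis using True by (simp add: sum.delta)
  next
    case False
    have "n + p \<noteq> 2 * j" if "j \<le> n" for j
    proof
      assume eq: "n + p = 2 * j"
      then have "n = 2 * (n - j) + p" using that by auto
      with False show False by blast
    qed
    then show ?thesis using False by auto
  qed
  finally show ?thesis .
qed

theorem von_mises_moment:
  "(LINT \<theta>|von_mises \<kappa>. cis (real p * \<theta>)) = of_real (circular_moment p \<kappa>)"
proof -
  define f where "f n \<theta> = indicator {-pi..pi} \<theta> *\<^sub>R
      (of_real (\<kappa> ^ n / fact n) * (of_real (cos \<theta> ^ n) * cis (real p * \<theta>)))" for n and \<theta> :: real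
  have int: "integrable lborel (f n)" for n
    using borel_integrable_atLeastAtMost'[of "-pi" pi
        "\<lambda>\<theta>. of_real (\<kappa> ^ n / fact n) * (of_real (cos \<theta> ^ n) * cis (real p * \<theta>))"]
    unfolding f_def set_integrable_def by (simp add: continuous_intros)
  have bound: "norm (f n \<theta>) \<le> indicator {-pi..pi} \<theta> * (\<bar>\<kappa>\<bar> ^ n / fact n)" for n \<theta>
  proof -
    have "\<bar>cos \<theta>\<bar> ^ n \<le> 1" by (intro power_le_one) auto
    then have "\<bar>\<kappa>\<bar> ^ n / fact n * \<bar>cos \<theta>\<bar> ^ n \<le> \<bar>\<kappa>\<bar> ^ n / fact n"
      by (intro mult_left_le) auto
    then show ?thesis
      by (simp add: f_def norm_mult norm_divide norm_power power_abs split: split_indicator)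
  qed
  have exp_summable: "summable (\<lambda>n. \<bar>\<kappa>\<bar> ^ n / fact n)"
    using summable_exp[of "\<bar>\<kappa>\<bar>"] by (simp add: field_simps)
  have "(\<lambda>n. integral\<^sup>L lborel (f n)) sums (\<integral>\<theta>. (\<Sum>n. f n \<theta>) \<partial>lborel)"
  proof (rule sums_integral[OF int])
    show "AE \<theta> in lborel. summable (\<lambda>n. norm (f n \<theta>))"
    proof (intro AE_I2 summable_comparison_test'[OF exp_summable])
      fix n \<theta>
      show "norm (norm (f n \<theta>)) \<le> \<bar>\<kappa>\<bar> ^ n / fact n"
        using bound[of n \<theta>] by (auto split: split_indicator_asm intro: order_trans)
    qed
    show "summable (\<lambda>n. \<integral>\<theta>. norm (f n \<theta>) \<partial>lborel)"
    proof (rule summable_comparison_test'[OF summable_mult[OF exp_summable, of "2 * pi"]])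
      fix n :: nat
      have "(\<integral>\<theta>. norm (f n \<theta>) \<partial>lborel) \<le> (\<integral>\<theta>. indicator {-pi..pi} \<theta> * (\<bar>\<kappa>\<bar> ^ n / fact n) \<partial>lborel)"
        using int bound by (intro integral_mono) (auto intro!: integrable_norm)
      then show "norm (\<integral>\<theta>. norm (f n \<theta>) \<partial>lborel) \<le> 2 * pi * (\<bar>\<kappa>\<bar> ^ n / fact n)"
        by simp
    qed
  qed
  moreover have "(\<Sum>n. f n \<theta>) = indicator {-pi..pi} \<theta> *\<^sub>R (of_real (exp (\<kappa> * cos \<theta>)) * cis (real p * \<theta>))"
    for \<theta>
  proof -
    have "(\<lambda>n. (\<kappa> * cos \<theta>) ^ n / fact n) sums exp (\<kappa> * cos \<theta>)"
      using exp_converges[of "\<kappa> * cos \<theta>"] by (simp add: field_simps)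
    from sums_scaleR_right[OF sums_mult2[OF sums_of_real[OF this]],
        of "indicator {-pi..pi} \<theta>" "cis (real p * \<theta>)"]
    have "(\<lambda>n. f n \<theta>) sums
        (indicator {-pi..pi} \<theta> *\<^sub>R (of_real (exp (\<kappa> * cos \<theta>)) * cis (real p * \<theta>)))"
      by (simp add: f_def power_mult_distrib field_simps)
    then show ?thesis by (rule sums_unique[symmetric])
  qed
  moreover have "integral\<^sup>L lborel (f n) = (if \<exists>k. n = 2 * k + p
      then of_real (2 * pi * ((\<kappa> / 2) ^ n / fact n * real (n choose ((n + p) div 2)))) else 0)" for n
  proof -
    have "integral\<^sup>L lborel (f n) = of_real (\<kappa> ^ n / fact n) *
       (LINT \<theta>:{-pi..pi}|lborel. of_real (cos \<theta> ^ n) * cis (real p * \<theta>))"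
      unfolding f_def set_lebesgue_integral_def
      by (subst integral_mult_right_zero[symmetric], rule Bochner_Integration.integral_cong)
         (simp_all only: mult_scaleR_right)
    then show ?thesis unfolding integral_cos_power_cis
      by (cases "\<exists>k. n = 2 * k + p") (simp_all only: if_True if_False mult_zero_right, simp add: field_simps)
  qed
  ultimately have "(\<lambda>n. if \<exists>k. n = 2 * k + p
      then of_real (2 * pi * ((\<kappa> / 2) ^ n / fact n * real (n choose ((n + p) div 2)))) else 0) sums
      (LINT \<theta>:{-pi..pi}|lborel. of_real (exp (\<kappa> * cos \<theta>)) * cis (real p * \<theta>))"
    (is "?a sums ?I") by (simp add: set_lebesgue_integral_def)
  moreover have "strict_mono (\<lambda>k. 2 * k + p)" by (auto simp: strict_mono_def)
  ultimately have "(\<lambda>k. ?a (2 * k + p)) sums ?I"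
    by (subst sums_mono_reindex) auto
  moreover have "?a (2 * k + p) = of_real (2 * pi * ((\<kappa> / 2) ^ (2 * k + p) / (fact k * fact (k + p))))" for k
  proof -
    have "(2 * k + p + p) div 2 = k + p" by simp
    moreover have "real ((2 * k + p) choose (k + p)) = fact (2 * k + p) / (fact (k + p) * fact k)"
      by (subst binomial_fact) auto
    then have "(\<kappa> / 2) ^ (2 * k + p) / fact (2 * k + p) * real ((2 * k + p) choose (k + p))
        = (\<kappa> / 2) ^ (2 * k + p) / (fact k * fact (k + p))"
      by (simp only:) simp
    moreover have "\<exists>k'. 2 * k + p = 2 * k' + p" by blast
    ultimately show ?thesis by (simp only: if_True)
  qed
  ultimately have "(\<lambda>k. of_real (2 * pi * ((\<kappa> / 2) ^ (2 * k + p) / (fact k * fact (k + p))))) sums ?I"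
    by simp
  moreover have "(\<lambda>k. of_real (2 * pi * ((\<kappa> / 2) ^ (2 * k + p) / (fact k * fact (k + p))))) sums
      (complex_of_real (2 * pi * bessel_I p \<kappa>))"
    unfolding bessel_I_def
    by (intro sums_of_real sums_mult summable_sums bessel_I_summable)
  ultimately have I: "?I = of_real (2 * pi * bessel_I p \<kappa>)" by (rule sums_unique2)
  have "(LINT \<theta>|von_mises \<kappa>. cis (real p * \<theta>)) =
      (\<integral>\<theta>. (indicator {-pi..pi} \<theta> * (exp (\<kappa> * cos \<theta>) / (2 * pi * bessel_I 0 \<kappa>))) *\<^sub>R cis (real p * \<theta>) \<partial>lborel)"
    unfolding von_mises_def using bessel_I_0_pos[of \<kappa>]
    by (intro integral_density) (auto intro!: borel_measurable_continuous_onI continuous_intros)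
  also have "\<dots> = of_real (1 / (2 * pi * bessel_I 0 \<kappa>)) * ?I"
    unfolding set_lebesgue_integral_def
    by (subst integral_mult_right_zero[symmetric])
       (simp add: scaleR_conv_of_real mult_ac divide_simps)
  also have "\<dots> = of_real (circular_moment p \<kappa>)"
    unfolding I circular_moment_def by (simp add: field_simps)
  finally show ?thesis .
qed

text \<open>The value is \<open>-\<infinity>\<close> at level 0, and \<open>\<infinity>\<close> at a level that no real
  argument of the distribution function reaches, so that a copula built from quantiles is
  total on the closed unit cube.\<close>

definition quantile :: "real measure \<Rightarrow> real \<Rightarrow> ereal" where
  "quantile M p = Inf (ereal ` {x. p \<le> cdf M x})"

definition student_t :: "real \<Rightarrow> real measure" where
  "student_t \<nu> = density lborel (\<lambda>x. ennreal
     (Gamma ((\<nu> + 1) / 2) / (sqrt (\<nu> * pi) * Gamma (\<nu> / 2))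
        * (1 + x\<^sup>2 / \<nu>) powr (- (\<nu> + 1) / 2)))"

definition multivariate_student_t :: "real \<Rightarrow> real ^ 'n ^ 'n \<Rightarrow> (real ^ 'n) measure" where
  "multivariate_student_t \<nu> \<Sigma> = density lborel (\<lambda>z. ennreal
     (Gamma ((\<nu> + real CARD('n)) / 2)
        / (Gamma (\<nu> / 2) * (\<nu> * pi) powr (real CARD('n) / 2) * sqrt (det \<Sigma>))
        * (1 + (z \<bullet> (matrix_inv \<Sigma> *v z)) / \<nu>) powr (- (\<nu> + real CARD('n)) / 2)))"

text \<open>The arguments are extended reals because quantiles are.\<close>

definition multivariate_student_t_cdf ::
    "real \<Rightarrow> real ^ 'n ^ 'n \<Rightarrow> ('n \<Rightarrow> ereal) \<Rightarrow> real" where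
  "multivariate_student_t_cdf \<nu> \<Sigma> x =
     measure (multivariate_student_t \<nu> \<Sigma>) {z. \<forall>i. ereal (z $ i) \<le> x i}"

definition student_t_copula :: "real \<Rightarrow> real ^ 'n ^ 'n \<Rightarrow> ('n \<Rightarrow> real) \<Rightarrow> real" where
  "student_t_copula \<nu> \<Sigma> v =
     multivariate_student_t_cdf \<nu> \<Sigma> (\<lambda>i. quantile (student_t \<nu>) (v i))"

definition positive_definite_correlation_matrix :: "real ^ 'n ^ 'n \<Rightarrow> bool" where
  "positive_definite_correlation_matrix \<Sigma> \<longleftrightarrow>
     transpose \<Sigma> = \<Sigma> \<and> (\<forall>i. \<Sigma> $ i $ i = 1) \<and> (\<forall>x. x \<noteq> 0 \<longrightarrow> 0 < x \<bullet> (\<Sigma> *v x))"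

definition has_copula ::
    "'a measure \<Rightarrow> ('n \<Rightarrow> 'a \<Rightarrow> real) \<Rightarrow> (('n \<Rightarrow> real) \<Rightarrow> real) \<Rightarrow> bool" where
  "has_copula M X C \<longleftrightarrow>
     (\<forall>x. measure M {\<omega> \<in> space M. \<forall>i. X i \<omega> \<le> x i} = C (\<lambda>i. cdf (distr M borel (X i)) (x i)))"

definition mean_gain :: "real \<Rightarrow> real \<Rightarrow> real \<Rightarrow> real \<Rightarrow> real" where
  "mean_gain \<beta> \<kappa> a\<^sub>b a\<^sub>u = \<beta>\<^sup>2 * (circular_moment 1 \<kappa>)\<^sup>2 * (sqrt (a\<^sub>b * a\<^sub>u)) ^ 4"

definition gain_shape :: "nat \<Rightarrow> real \<Rightarrow> real \<Rightarrow> real \<Rightarrow> real" where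
  "gain_shape K \<kappa> a\<^sub>b a\<^sub>u = real K / 2 * ((circular_moment 1 \<kappa>)\<^sup>2 * (sqrt (a\<^sub>b * a\<^sub>u)) ^ 4
     / (1 + circular_moment 2 \<kappa> - 2 * (circular_moment 1 \<kappa>)\<^sup>2 * (sqrt (a\<^sub>b * a\<^sub>u)) ^ 4))"

definition gamma_density :: "real \<Rightarrow> real \<Rightarrow> real \<Rightarrow> real" where
  "gamma_density m gbar g = (if 0 < g
     then m powr m / (Gamma m * gbar powr m) * g powr (m - 1) * exp (- m * g / gbar) else 0)"

datatype user = User_r | User_t

fun other_user :: "user \<Rightarrow> user" where
  "other_user User_r = User_t"
| "other_user User_t = User_r"

text \<open>Below, \<open>snr\<close> is the average transmit SNR, \<open>x\<close> the gain \<open>g_fas\<close> of the selected port,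
  and \<open>th\<close> a decoding threshold.\<close>

definition sinr_c :: "real \<Rightarrow> (user \<Rightarrow> real) \<Rightarrow> real \<Rightarrow> nat \<Rightarrow> real \<Rightarrow> real \<Rightarrow> real" where
  "sinr_c \<alpha>\<^sub>c \<alpha>\<^sub>p L K snr x =
     snr * \<alpha>\<^sub>c * L * (real K)\<^sup>2 * x / (snr * (\<alpha>\<^sub>p User_r + \<alpha>\<^sub>p User_t) * L * (real K)\<^sup>2 * x + 1)"

definition sinr_p :: "(user \<Rightarrow> real) \<Rightarrow> user \<Rightarrow> real \<Rightarrow> nat \<Rightarrow> real \<Rightarrow> real \<Rightarrow> real" where
  "sinr_p \<alpha>\<^sub>p u L K snr x =
     snr * \<alpha>\<^sub>p u * L * (real K)\<^sup>2 * x / (snr * \<alpha>\<^sub>p (other_user u) * L * (real K)\<^sup>2 * x + 1)"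

definition threshold_c :: "real \<Rightarrow> (user \<Rightarrow> real) \<Rightarrow> real \<Rightarrow> nat \<Rightarrow> real \<Rightarrow> real \<Rightarrow> real" where
  "threshold_c \<alpha>\<^sub>c \<alpha>\<^sub>p L K th snr =
     th / (snr * L * (real K)\<^sup>2 * (\<alpha>\<^sub>c - (\<alpha>\<^sub>p User_r + \<alpha>\<^sub>p User_t) * th))"

definition threshold_p :: "(user \<Rightarrow> real) \<Rightarrow> user \<Rightarrow> real \<Rightarrow> nat \<Rightarrow> real \<Rightarrow> real \<Rightarrow> real" where
  "threshold_p \<alpha>\<^sub>p u L K th snr =
     th / (snr * L * (real K)\<^sup>2 * (\<alpha>\<^sub>p u - \<alpha>\<^sub>p (other_user u) * th))"

end

theory Submission
  imports Defs
begin

text \<open>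
  Almost surely the outage event is that all port gains lie below \<open>\<gamma>\<^sub>t\<^sub>h\<close>, so the outage
  probability is the copula on the diagonal at \<open>F(\<gamma>\<^sub>t\<^sub>h)\<close>, whereas the approximation is
  the copula on the diagonal at the leading term \<open>v\<close> of \<open>F(\<gamma>\<^sub>t\<^sub>h)\<close>. Write \<open>G\<close> for the
  univariate Student distribution function, \<open>D(t) = T(t, \<dots>, t)\<close>, \<open>v = G(-a)\<close> and
  \<open>F(\<gamma>\<^sub>t\<^sub>h) = G(-b)\<close> with \<open>a \<le> b\<close>. Dilating by \<open>r = b / a\<close> gives
  \<open>r powr -\<nu> * D(-a) \<le> D(-b) \<le> D(-a)\<close> and, in dimension one, also the reverse bound
  \<open>G(-b) \<le> (1 + o(1)) * r powr -\<nu> * G(-a)\<close> as \<open>a \<rightarrow> \<infinity>\<close>. As \<open>F(\<gamma>\<^sub>t\<^sub>h) / v \<rightarrow> 1\<close>,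
  the second estimate forces \<open>r powr -\<nu> \<rightarrow> 1\<close>, and the first one then gives the claim.
\<close>

section \<open>Positivity of the shape and the mean gain\<close>

lemma circular_moment_pos:
  assumes "\<kappa> > 0"
  shows "0 < circular_moment p \<kappa>"
proof -
  have "0 < bessel_I p \<kappa>"
    unfolding bessel_I_def using assms by (intro suminf_pos bessel_I_summable) auto
  then show ?thesis
    using bessel_I_0_pos by (simp add: circular_moment_def)
qed

text \<open>This is strict positivity of the variance of \<open>cos \<theta>\<close> under the von Mises law.\<close>

lemma circular_moment_variance:
  "2 * (circular_moment 1 \<kappa>)\<^sup>2 < 1 + circular_moment 2 \<kappa>"
proof -
  let ?V = "von_mises \<kappa>" and ?f = "\<lambda>\<theta>. exp (\<kappa> * cos \<theta>) / (2 * pi * bessel_I 0 \<kappa>)"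
  let ?c = "circular_moment 1 \<kappa>"
  have [simp]: "sets ?V = sets borel" "space ?V = UNIV" by (simp_all add: von_mises_def)
  have fpos: "0 < ?f \<theta>" for \<theta> using bessel_I_0_pos[of \<kappa>] by simp
  \<comment> \<open>The zeroth moment integrates the constant 1, so \<open>von_mises_moment\<close>
    with \<open>p = 0\<close> yields the total mass.\<close>
  have "measure ?V UNIV = 1"
  proof -
    have "complex_of_real (measure ?V UNIV) = (LINT \<theta>|?V. cis (real 0 * \<theta>))"
      by (simp add: scaleR_conv_of_real)
    also have "\<dots> = of_real (circular_moment 0 \<kappa>)" by (rule von_mises_moment)
    finally show ?thesis using bessel_I_0_pos[of \<kappa>] by (simp add: circular_moment_def)
  qed
  \<comment> \<open>An infinite mass is excluded because \<open>measure\<close> would then return 0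
    instead of 1.\<close>
  then interpret prob_space ?V
    by (intro prob_spaceI, cases "emeasure ?V UNIV") (auto simp: measure_def)
  have int: "integrable ?V (\<lambda>\<theta>. cis (real p * \<theta>))" for p
    by (rule integrable_const_bound[of _ 1])
       (auto intro!: borel_measurable_continuous_onI continuous_intros cong: measurable_cong_sets)
  have cos_moment: "(LINT \<theta>|?V. cos (real p * \<theta>)) = circular_moment p \<kappa>" for p
    using von_mises_moment[of \<kappa> p] integral_Re[OF int[of p]] by simp
  have cos_int: "integrable ?V (\<lambda>\<theta>. cos (real p * \<theta>))" for p
    using integrable_Re[OF int[of p]] by simp
  have sq: "(cos \<theta> - ?c)\<^sup>2 = cos (real 2 * \<theta>) / 2 - 2 * ?c * cos (real 1 * \<theta>) + (1 / 2 + ?c\<^sup>2)" for \<theta>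
    using cos_double_cos[of \<theta>] by (simp add: power2_diff diff_divide_distrib)
  have int_sq: "integrable ?V (\<lambda>\<theta>. (cos \<theta> - ?c)\<^sup>2)"
    unfolding sq using cos_int[of 1] cos_int[of 2] by auto
  have "(LINT \<theta>|?V. (cos \<theta> - ?c)\<^sup>2)
      = circular_moment 2 \<kappa> / 2 - 2 * ?c * ?c + (1 / 2 + ?c\<^sup>2)"
    unfolding sq using cos_int[of 1] cos_int[of 2] cos_moment[of 1] cos_moment[of 2] prob_space by simp
  then have var: "2 * (LINT \<theta>|?V. (cos \<theta> - ?c)\<^sup>2) = 1 + circular_moment 2 \<kappa> - 2 * ?c\<^sup>2"
    by (simp add: power2_eq_square algebra_simps)
  \<comment> \<open>If the variance vanished, the cosine would equal \<open>?c\<close> almost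
    everywhere on \<open>{-pi..pi}\<close>. It is injective on \<open>{0..pi}\<close>, so almost
    every point there would be the single point \<open>arccos ?c\<close>, although this interval has
    positive length.\<close>
  have "(LINT \<theta>|?V. (cos \<theta> - ?c)\<^sup>2) \<noteq> 0"
  proof
    assume "(LINT \<theta>|?V. (cos \<theta> - ?c)\<^sup>2) = 0"
    then have "AE \<theta> in ?V. (cos \<theta> - ?c)\<^sup>2 = 0"
      using integral_nonneg_eq_0_iff_AE[OF int_sq] by simp
    then have "AE \<theta> in lborel. \<theta> \<in> {-pi..pi} \<longrightarrow> cos \<theta> = ?c"
      using fpos unfolding von_mises_def
      by (subst (asm) AE_density) (auto elim!: eventually_mono split: split_indicator_asm)
    moreover have "AE \<theta> in lborel. \<theta> \<noteq> arccos ?c"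
      by (intro AE_I[where N="{arccos ?c}"]) auto
    ultimately have "AE \<theta> in lborel. \<theta> \<notin> {0..pi}"
    proof eventually_elim
      case (elim \<theta>)
      then show ?case using arccos_cos[of \<theta>] by auto
    qed
    then have "emeasure lborel {0..pi} = 0"
      by (intro AE_iff_measurable[THEN iffD1, rotated 2]) auto
    then show False by simp
  qed
  moreover have "0 \<le> (LINT \<theta>|?V. (cos \<theta> - ?c)\<^sup>2)" by simp
  ultimately show ?thesis using var by linarith
qed

lemma mean_gain_pos:
  assumes "\<kappa> > 0" and "\<beta> \<in> {0<..1}" and "a\<^sub>b \<in> {0<..1}" and "a\<^sub>u \<in> {0<..1}"
  shows "0 < mean_gain \<beta> \<kappa> a\<^sub>b a\<^sub>u"
  using assms circular_moment_pos[of \<kappa> 1] by (simp add: mean_gain_def)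

text \<open>Only the sign of the denominator is at issue. The fading factor \<open>?a\<close> is at
  most 1, so the subtracted term is at most the one in
  \<open>circular_moment_variance\<close>.\<close>

lemma gain_shape_pos:
  assumes "K \<ge> 1" and "\<kappa> > 0" and "a\<^sub>b \<in> {0<..1}" and "a\<^sub>u \<in> {0<..1}"
  shows "0 < gain_shape K \<kappa> a\<^sub>b a\<^sub>u"
proof -
  let ?a = "(sqrt (a\<^sub>b * a\<^sub>u)) ^ 4"
  have "0 < ?a" using assms by simp
  moreover have "?a \<le> 1" using assms by (intro power_le_one) (auto simp: mult_le_one)
  then have "2 * (circular_moment 1 \<kappa>)\<^sup>2 * ?a \<le> 2 * (circular_moment 1 \<kappa>)\<^sup>2"
    by (intro mult_left_le) auto
  then have "0 < 1 + circular_moment 2 \<kappa> - 2 * (circular_moment 1 \<kappa>)\<^sup>2 * ?a"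
    using circular_moment_variance[of \<kappa>] by linarith
  ultimately show ?thesis
    unfolding gain_shape_def using assms circular_moment_pos[of \<kappa> 1]
    by (intro mult_pos_pos divide_pos_pos) auto
qed

section \<open>The gamma distribution function near the origin\<close>

text \<open>On \<open>(0, x]\<close> the exponential factor of the density lies between
  \<open>exp (- m * x / gbar)\<close> and 1, while the remaining power of \<open>g\<close>
  integrates exactly to \<open>v\<close>.\<close>

lemma gamma_cdf_bounds:
  assumes "0 < m" and "0 < gbar" and "0 < x" and "prob_space M"
    and X: "distributed M lborel X (\<lambda>x. ennreal (gamma_density m gbar x))"
  defines "v \<equiv> 1 / (m * Gamma m) * (m * x / gbar) powr m"
  shows "exp (- m * x / gbar) * v \<le> cdf (distr M borel X) x"
    and "cdf (distr M borel X) x \<le> v"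
proof -
  interpret prob_space M by fact
  have [measurable]: "X \<in> borel_measurable M"
    using distributed_measurable[OF X] by simp
  define c where "c = m powr m / (Gamma m * gbar powr m)"
  let ?h = "\<lambda>g. ennreal (c * g powr (m - 1)) * indicator {0..x} g"
  have c: "0 < c" using assms Gamma_real_pos[of m] by (simp add: c_def)
  \<comment> \<open>For \<open>m < 1\<close> the power is unbounded at 0 but still integrable, since
    its exponent exceeds -1.\<close>
  have "((\<lambda>g. g powr (m - 1)) has_integral (x powr (m - 1 + 1) / (m - 1 + 1))) {0..x}"
    by (rule has_integral_powr_from_0) (use assms in auto)
  from has_integral_mult_right[OF this, of c]
  have "((\<lambda>g. c * g powr (m - 1)) has_integral v) {0..x}"
    using assms by (simp add: v_def c_def powr_mult powr_divide mult_ac)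
  then have v: "(\<integral>\<^sup>+g. ?h g \<partial>lborel) = ennreal v"
    by (intro nn_integral_has_integral_lebesgue') (use c in auto)
  have "0 \<le> v" using assms Gamma_real_pos[of m] by (simp add: v_def)
  have cdf: "ennreal (cdf (distr M borel X) x)
      = (\<integral>\<^sup>+g. ennreal (gamma_density m gbar g) * indicator {..x} g \<partial>lborel)"
    using distributed_emeasure[OF X, of "{..x}"]
    by (simp add: cdf_def measure_distr emeasure_eq_measure)
  have dens: "gamma_density m gbar g = c * g powr (m - 1) * exp (- m * g / gbar)" if "0 < g" for g
    using that by (simp add: gamma_density_def c_def)
  have "ennreal (cdf (distr M borel X) x) \<le> (\<integral>\<^sup>+g. ?h g \<partial>lborel)"
    unfolding cdf
  proof (intro nn_integral_mono)
    fix g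
    have "c * g powr (m - 1) * exp (- m * g / gbar) \<le> c * g powr (m - 1)" if "0 < g"
      using that c assms by (intro mult_left_le) auto
    then show "ennreal (gamma_density m gbar g) * indicator {..x} g \<le> ?h g"
      using dens[of g] by (cases "0 < g") (auto simp: gamma_density_def intro: ennreal_leI split: split_indicator)
  qed
  then show "cdf (distr M borel X) x \<le> v"
    using \<open>0 \<le> v\<close> unfolding v by simp
  have "ennreal (exp (- m * x / gbar) * v) = (\<integral>\<^sup>+g. ennreal (exp (- m * x / gbar)) * ?h g \<partial>lborel)"
    using \<open>0 \<le> v\<close> by (subst nn_integral_cmult) (auto simp: v ennreal_mult)
  also have "\<dots> \<le> ennreal (cdf (distr M borel X) x)"
    unfolding cdf
  proof (intro nn_integral_mono)
    fix g
    show "ennreal (exp (- m * x / gbar)) * ?h g \<le> ennreal (gamma_density m gbar g) * indicator {..x} g"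
    proof (cases "0 < g \<and> g \<le> x")
      case True
      then have "exp (- m * x / gbar) * (c * g powr (m - 1)) \<le> exp (- m * g / gbar) * (c * g powr (m - 1))"
        using c assms by (intro mult_right_mono) (auto simp: divide_right_mono)
      then have "ennreal (exp (- m * x / gbar) * (c * g powr (m - 1))) \<le> ennreal (gamma_density m gbar g)"
        using True dens[of g] by (intro ennreal_leI) (simp add: mult_ac)
      then show ?thesis
        using True by (simp add: ennreal_mult')
    next
      \<comment> \<open>At \<open>g = 0\<close> the left side vanishes because
        \<open>0 powr (m - 1) = 0\<close>; the other points lie outside
        \<open>{0..x}\<close>.\<close>
      case False
      then show ?thesis by (auto split: split_indicator simp: not_less)
    qed
  qed
  finally show "exp (- m * x / gbar) * v \<le> cdf (distr M borel X) x"
    by (simp add: cdf_def)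
qed

section \<open>Dilation of Student-type kernels\<close>

text \<open>The univariate and the multivariate Student density both have this shape, with
  \<open>Q\<close> the square or a quadratic form, so one dilation argument serves both. The
  constant is a separate factor and passes through the integrals unchanged.\<close>

definition student_kernel ::
    "real \<Rightarrow> real \<Rightarrow> ('a::euclidean_space \<Rightarrow> real) \<Rightarrow> 'a measure" where
  "student_kernel c \<nu> Q = density lborel
     (\<lambda>z. ennreal c * ennreal ((1 + Q z / \<nu>) powr (- (\<nu> + DIM('a)) / 2)))"

lemma student_t_eq_kernel:
  "student_t \<nu> = student_kernel (Gamma ((\<nu> + 1) / 2) / (sqrt (\<nu> * pi) * Gamma (\<nu> / 2))) \<nu> power2"
  by (simp add: student_t_def student_kernel_def ennreal_mult''[symmetric])

lemma multivariate_student_t_eq_kernel: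
  "multivariate_student_t \<nu> (\<Sigma> :: real ^ 'n ^ 'n) = student_kernel
     (Gamma ((\<nu> + real CARD('n)) / 2)
        / (Gamma (\<nu> / 2) * (\<nu> * pi) powr (real CARD('n) / 2) * sqrt (det \<Sigma>)))
     \<nu> (\<lambda>z. z \<bullet> (matrix_inv \<Sigma> *v z))"
  by (simp add: multivariate_student_t_def student_kernel_def ennreal_mult''[symmetric])

lemma emeasure_student_kernel:
  assumes [measurable]: "Q \<in> borel_measurable borel" "S \<in> sets borel"
  shows "emeasure (student_kernel c \<nu> Q) S = (\<integral>\<^sup>+z. ennreal c *
     ennreal ((1 + Q z / \<nu>) powr (- (\<nu> + DIM('a::euclidean_space)) / 2)) * indicator S (z::'a) \<partial>lborel)"
  unfolding student_kernel_def by (rule emeasure_density) measurable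

text \<open>Substituting \<open>r *\<^sub>R z\<close> for \<open>z\<close> contributes the Jacobian
  \<open>r powr DIM('a)\<close>, homogeneity puts \<open>r\<^sup>2\<close> in front of
  \<open>Q\<close>, and the indicator of the dilated set becomes that of \<open>S\<close>.\<close>

lemma emeasure_student_kernel_scale:
  fixes Q :: "'a::euclidean_space \<Rightarrow> real"
  assumes [measurable]: "Q \<in> borel_measurable borel" "S \<in> sets borel"
    and hom: "\<And>r z. Q (r *\<^sub>R z) = r\<^sup>2 * Q z" and "r > 0"
  shows "emeasure (student_kernel c \<nu> Q) {z. z /\<^sub>R r \<in> S} = (\<integral>\<^sup>+z. ennreal c *
     ennreal (r powr DIM('a) * (1 + r\<^sup>2 * Q z / \<nu>) powr (- (\<nu> + DIM('a)) / 2)) * indicator S z \<partial>lborel)"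
proof -
  let ?f = "\<lambda>z. ennreal c * ennreal ((1 + Q z / \<nu>) powr (- (\<nu> + DIM('a)) / 2))
      * indicator {z. z /\<^sub>R r \<in> S} z"
  have "emeasure (student_kernel c \<nu> Q) {z. z /\<^sub>R r \<in> S} = (\<integral>\<^sup>+z. ?f z \<partial>lborel)"
    by (rule emeasure_student_kernel) measurable
  also have "\<dots> = (\<integral>\<^sup>+z. ?f z \<partial>density (distr lborel borel (\<lambda>x. 0 + r *\<^sub>R x)) (\<lambda>_. \<bar>r\<bar> ^ DIM('a)))"
    by (subst lborel_affine[of r 0]) (use \<open>r > 0\<close> in auto)
  also have "\<dots> = (\<integral>\<^sup>+z. ennreal (\<bar>r\<bar> ^ DIM('a)) * ?f (r *\<^sub>R z) \<partial>lborel)"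
    by (simp add: nn_integral_density nn_integral_distr)
  also have "\<dots> = (\<integral>\<^sup>+z. ennreal c *
     ennreal (r powr DIM('a) * (1 + r\<^sup>2 * Q z / \<nu>) powr (- (\<nu> + DIM('a)) / 2)) * indicator S z \<partial>lborel)"
    using \<open>r > 0\<close> by (intro nn_integral_cong)
      (simp add: hom powr_realpow ennreal_mult'' mult_ac split: split_indicator)
  finally show ?thesis .
qed

text \<open>The Jacobian \<open>r powr d\<close> cancels the dimension in the exponent. Hence the
  factor \<open>r powr - \<nu>\<close> is the same in every dimension, which lets the univariate
  tail control the multivariate one.\<close>

lemma powr_scale_identity:
  fixes r x \<nu> d :: real
  assumes "r > 0" and "x > 0"
  shows "r powr - \<nu> * x powr (- (\<nu> + d) / 2) = r powr d * (r\<^sup>2 * x) powr (- (\<nu> + d) / 2)"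
proof -
  have "(r\<^sup>2) powr (- (\<nu> + d) / 2) = r powr (2 * (- (\<nu> + d) / 2))"
    using assms by (simp only: powr_powr flip: powr_numeral)
  also have "2 * (- (\<nu> + d) / 2) = - \<nu> - d" by simp
  finally show ?thesis
    using assms by (simp only: powr_mult mult.assoc[symmetric] powr_add[symmetric]) simp
qed

text \<open>The integrands are compared pointwise: for \<open>r \<ge> 1\<close> the base
  \<open>1 + r\<^sup>2 * Q z / \<nu>\<close> is at most
  \<open>r\<^sup>2 * (1 + Q z / \<nu>)\<close>, and the negative exponent reverses the
  inequality.\<close>

lemma student_kernel_scale_ge:
  fixes Q :: "'a::euclidean_space \<Rightarrow> real"
  assumes Q: "Q \<in> borel_measurable borel" "\<And>r z. Q (r *\<^sub>R z) = r\<^sup>2 * Q z" "\<And>z. 0 \<le> Q z"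
    and S: "S \<in> sets borel" and "\<nu> > 0" and "r \<ge> 1"
  shows "ennreal (r powr - \<nu>) * emeasure (student_kernel c \<nu> Q) S
    \<le> emeasure (student_kernel c \<nu> Q) {z. z /\<^sub>R r \<in> S}"
proof -
  have [measurable]: "Q \<in> borel_measurable borel" "S \<in> sets borel" by fact+
  have le: "r powr - \<nu> * (1 + Q z / \<nu>) powr (- (\<nu> + DIM('a)) / 2)
      \<le> r powr DIM('a) * (1 + r\<^sup>2 * Q z / \<nu>) powr (- (\<nu> + DIM('a)) / 2)" for z
  proof -
    have q: "0 \<le> Q z / \<nu>" using Q(3) \<open>\<nu> > 0\<close> by simp
    have "1 + r\<^sup>2 * Q z / \<nu> \<le> r\<^sup>2 * (1 + Q z / \<nu>)"
      using \<open>r \<ge> 1\<close> by (simp add: algebra_simps)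
    moreover have "0 < 1 + r\<^sup>2 * Q z / \<nu>"
      using q by (metis add_pos_nonneg less_numeral_extra(1) mult_nonneg_nonneg times_divide_eq_right zero_le_power2)
    ultimately have "(r\<^sup>2 * (1 + Q z / \<nu>)) powr (- (\<nu> + DIM('a)) / 2)
        \<le> (1 + r\<^sup>2 * Q z / \<nu>) powr (- (\<nu> + DIM('a)) / 2)"
      using \<open>\<nu> > 0\<close> by (intro powr_mono2') auto
    then show ?thesis
      using q \<open>r \<ge> 1\<close> by (subst powr_scale_identity) (auto intro: mult_left_mono)
  qed
  have "ennreal (r powr - \<nu>) * emeasure (student_kernel c \<nu> Q) S = (\<integral>\<^sup>+z. ennreal c *
     ennreal (r powr - \<nu> * (1 + Q z / \<nu>) powr (- (\<nu> + DIM('a)) / 2)) * indicator S z \<partial>lborel)"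
    by (simp add: emeasure_student_kernel nn_integral_cmult[symmetric] ennreal_mult'' mult_ac)
  also have "\<dots> \<le> emeasure (student_kernel c \<nu> Q) {z. z /\<^sub>R r \<in> S}"
    using \<open>r \<ge> 1\<close> Q S le
    by (subst emeasure_student_kernel_scale)
       (auto intro!: nn_integral_mono mult_right_mono mult_left_mono ennreal_leI)
  finally show ?thesis .
qed

text \<open>Assumption \<open>far\<close> absorbs the summand 1 into \<open>Q z / \<nu>\<close> at
  the cost of a factor \<open>k\<close>. On \<open>S\<close> the kernel is thus comparable, up to a
  power of \<open>k\<close>, to its homogeneous part, which scales exactly.\<close>

lemma student_kernel_scale_le:
  fixes Q :: "'a::euclidean_space \<Rightarrow> real"
  assumes Q: "Q \<in> borel_measurable borel" "\<And>r z. Q (r *\<^sub>R z) = r\<^sup>2 * Q z" "\<And>z. 0 \<le> Q z"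
    and S: "S \<in> sets borel" and "\<nu> > 0" and "r \<ge> 1" and "k > 0"
    and far: "\<And>z. z \<in> S \<Longrightarrow> 1 + Q z / \<nu> \<le> k * (Q z / \<nu>)"
  shows "emeasure (student_kernel c \<nu> Q) {z. z /\<^sub>R r \<in> S}
    \<le> ennreal (k powr ((\<nu> + DIM('a)) / 2) * r powr - \<nu>) * emeasure (student_kernel c \<nu> Q) S"
proof -
  have [measurable]: "Q \<in> borel_measurable borel" "S \<in> sets borel" by fact+
  have le: "r powr DIM('a) * (1 + r\<^sup>2 * Q z / \<nu>) powr (- (\<nu> + DIM('a)) / 2)
    \<le> k powr ((\<nu> + DIM('a)) / 2) * r powr - \<nu> * (1 + Q z / \<nu>) powr (- (\<nu> + DIM('a)) / 2)"
    if "z \<in> S" for z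
  proof -
    have q: "0 \<le> Q z / \<nu>" using Q(3) \<open>\<nu> > 0\<close> by simp
    have "r\<^sup>2 * (1 + Q z / \<nu>) \<le> r\<^sup>2 * (k * (Q z / \<nu>))"
      using far[OF that] by (intro mult_left_mono) auto
    also have "\<dots> \<le> (1 + r\<^sup>2 * Q z / \<nu>) * k"
      using \<open>k > 0\<close> by (simp add: algebra_simps)
    finally have "r\<^sup>2 * (1 + Q z / \<nu>) / k \<le> 1 + r\<^sup>2 * Q z / \<nu>"
      using \<open>k > 0\<close> by (simp add: pos_divide_le_eq)
    moreover have "0 < r\<^sup>2 * (1 + Q z / \<nu>) / k"
      using q \<open>k > 0\<close> \<open>r \<ge> 1\<close> by (intro divide_pos_pos mult_pos_pos) auto
    ultimately have "(1 + r\<^sup>2 * Q z / \<nu>) powr (- (\<nu> + DIM('a)) / 2)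
        \<le> (r\<^sup>2 * (1 + Q z / \<nu>) / k) powr (- (\<nu> + DIM('a)) / 2)"
      using \<open>\<nu> > 0\<close> by (intro powr_mono2') auto
    also have "\<dots> = k powr ((\<nu> + DIM('a)) / 2) * (r\<^sup>2 * (1 + Q z / \<nu>)) powr (- (\<nu> + DIM('a)) / 2)"
    proof -
      have "- (\<nu> + DIM('a)) / 2 = - ((\<nu> + DIM('a)) / 2)" by (rule minus_divide_left[symmetric])
      then show ?thesis
        using q \<open>k > 0\<close> by (simp only: powr_divide powr_minus) (simp add: divide_simps)
    qed
    finally show ?thesis
      unfolding mult.assoc
      using q \<open>r \<ge> 1\<close> by (subst powr_scale_identity) (auto simp: mult_ac intro: mult_left_mono)
  qed
  have "emeasure (student_kernel c \<nu> Q) {z. z /\<^sub>R r \<in> S} \<le> (\<integral>\<^sup>+z. ennreal c * ennreal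
     (k powr ((\<nu> + DIM('a)) / 2) * r powr - \<nu> * (1 + Q z / \<nu>) powr (- (\<nu> + DIM('a)) / 2)) * indicator S z \<partial>lborel)"
    using \<open>r \<ge> 1\<close> Q S le
    by (subst emeasure_student_kernel_scale)
       (auto intro!: nn_integral_mono mult_left_mono ennreal_leI split: split_indicator)
  also have "\<dots> = ennreal (k powr ((\<nu> + DIM('a)) / 2) * r powr - \<nu>) * emeasure (student_kernel c \<nu> Q) S"
    by (simp add: emeasure_student_kernel nn_integral_cmult[symmetric] ennreal_mult'' mult_ac)
  finally show ?thesis .
qed

section \<open>The multivariate Student law on the diagonal\<close>

text \<open>With \<open>w = matrix_inv \<Sigma> *v z\<close> one has
  \<open>z = \<Sigma> *v w\<close>, so the form at \<open>z\<close> is the form of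
  \<open>\<Sigma>\<close> at \<open>w\<close>. Positive definiteness also gives the trivial kernel,
  hence invertibility.\<close>

lemma matrix_inv_quadratic_form_nonneg:
  assumes "positive_definite_correlation_matrix \<Sigma>"
  shows "0 \<le> z \<bullet> (matrix_inv \<Sigma> *v z)"
proof -
  have pd: "x \<noteq> 0 \<Longrightarrow> 0 < x \<bullet> (\<Sigma> *v x)" for x
    using assms by (auto simp: positive_definite_correlation_matrix_def)
  then have "\<forall>x. \<Sigma> *v x = 0 \<longrightarrow> x = 0"
    by (metis inner_zero_right less_irrefl)
  then have "invertible \<Sigma>"
    by (simp add: invertible_left_inverse matrix_left_invertible_ker)
  then have "\<Sigma> ** matrix_inv \<Sigma> = mat 1"
    unfolding invertible_def matrix_inv_def by (rule someI2_ex) auto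
  then have "\<Sigma> *v (matrix_inv \<Sigma> *v z) = z"
    by (simp add: matrix_vector_mul_assoc)
  then show ?thesis
    using pd[of "matrix_inv \<Sigma> *v z"] 
    by (metis inner_commute inner_zero_right order.strict_implies_order order_refl)
qed

definition diagonal_cdf :: "real \<Rightarrow> real ^ 'n ^ 'n \<Rightarrow> real \<Rightarrow> real" where
  "diagonal_cdf \<nu> \<Sigma> t = multivariate_student_t_cdf \<nu> \<Sigma> (\<lambda>_. ereal t)"

text \<open>Dilation by \<open>b / a\<close> carries the orthant below \<open>- a\<close> onto the
  orthant below \<open>- b\<close>, so the first bound is an instance of
  \<open>student_kernel_scale_ge\<close>. The second is inclusion of the orthants.\<close>

lemma diagonal_cdf_bounds:
  fixes \<Sigma> :: "real ^ 'n ^ 'n"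
  assumes \<Sigma>: "positive_definite_correlation_matrix \<Sigma>" and "\<nu> > 0" and "0 < a" and "a \<le> b"
  shows "(b / a) powr - \<nu> * diagonal_cdf \<nu> \<Sigma> (- a) \<le> diagonal_cdf \<nu> \<Sigma> (- b)"
    and "diagonal_cdf \<nu> \<Sigma> (- b) \<le> diagonal_cdf \<nu> \<Sigma> (- a)"
proof -
  let ?M = "multivariate_student_t \<nu> \<Sigma>"
  let ?S = "\<lambda>t. {z :: real ^ 'n. \<forall>i. z $ i \<le> t}"
  have S: "?S t \<in> sets borel" for t :: real
  proof -
    have "?S t = (\<Inter>i. {z. z $ i \<le> t})" by auto
    also have "\<dots> \<in> sets borel"
      by (intro borel_closed closed_INT ballI) (intro closed_Collect_le continuous_intros)
    finally show ?thesis .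
  qed
  have [simp]: "sets ?M = sets borel" by (simp add: multivariate_student_t_def)
  have "(z /\<^sub>R (b / a)) $ i \<le> - a \<longleftrightarrow> z $ i \<le> - b" for z :: "real ^ 'n" and i
  proof -
    have "(z /\<^sub>R (b / a)) $ i \<le> - a \<longleftrightarrow> a * z $ i \<le> a * - b"
      using \<open>0 < a\<close> \<open>a \<le> b\<close> by (simp add: field_simps)
    then show ?thesis using \<open>0 < a\<close> by (simp only: mult_le_cancel_left_pos)
  qed
  then have "{z. z /\<^sub>R (b / a) \<in> ?S (- a)} = ?S (- b)" by simp
  moreover have "(\<lambda>z::real^'n. z \<bullet> (matrix_inv \<Sigma> *v z)) \<in> borel_measurable borel"
    by (intro borel_measurable_continuous_onI continuous_intros)
  ultimately have ge: "ennreal ((b / a) powr - \<nu>) * emeasure ?M (?S (- a)) \<le> emeasure ?M (?S (- b))"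
    using student_kernel_scale_ge[of "\<lambda>z. z \<bullet> (matrix_inv \<Sigma> *v z)" "?S (- a)" \<nu> "b / a"]
      assms matrix_inv_quadratic_form_nonneg[OF \<Sigma>] S
    by (simp add: multivariate_student_t_eq_kernel matrix_vector_mult_scaleR power2_eq_square mult.assoc)
  have le: "emeasure ?M (?S (- b)) \<le> emeasure ?M (?S (- a))"
    using S \<open>a \<le> b\<close> by (intro emeasure_mono) (auto intro: order_trans)
  have D: "diagonal_cdf \<nu> \<Sigma> t = enn2real (emeasure ?M (?S t))" for t
    by (simp add: diagonal_cdf_def multivariate_student_t_cdf_def measure_def)
  have r: "0 < (b / a) powr - \<nu>" using assms by simp
  \<comment> \<open>The two masses are finite together; if both are infinite, \<open>measure\<close> returns 0 for both.\<close>
  show "(b / a) powr - \<nu> * diagonal_cdf \<nu> \<Sigma> (- a) \<le> diagonal_cdf \<nu> \<Sigma> (- b)"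
    and "diagonal_cdf \<nu> \<Sigma> (- b) \<le> diagonal_cdf \<nu> \<Sigma> (- a)"
  proof (goal_cases)
    case 1
    show ?case
    proof (cases "emeasure ?M (?S (- b)) = \<infinity>")
      case True
      with le have "emeasure ?M (?S (- a)) = \<infinity>" by (simp add: top_unique)
      then show ?thesis by (simp add: D)
    next
      case False
      then show ?thesis
        using enn2real_mono[OF ge] r by (simp add: D enn2real_mult less_top)
    qed
  next
    case 2
    show ?case
    proof (cases "emeasure ?M (?S (- a)) = \<infinity>")
      case True
      with ge r have "emeasure ?M (?S (- b)) = \<infinity>"
        by (simp add: top_unique ennreal_mult_eq_top_iff ennreal_mult_top)
      then show ?thesis by (simp add: D)
    next
      case False
      then show ?thesis using enn2real_mono[OF le] by (simp add: D less_top)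
    qed
  qed
qed

section \<open>The univariate Student law: finiteness, quantiles and tail\<close>

lemma nn_integral_powr_neg_finite:
  assumes "\<nu> > 0"
  shows "(\<integral>\<^sup>+x. ennreal (x powr (- \<nu> - 1)) * indicator {1..} x \<partial>lborel) < \<infinity>"
proof -
  have "((\<lambda>x. x powr (- \<nu> - 1)) has_integral - (1 powr (- \<nu> - 1 + 1)) / (- \<nu> - 1 + 1)) {1..}"
    by (rule has_integral_powr_to_inf) (use assms in auto)
  from nn_integral_has_integral_lebesgue'[OF _ this] show ?thesis by simp
qed

text \<open>The kernel is even, bounded by 1, and for \<open>\<bar>x\<bar> \<ge> 1\<close> dominated
  by a multiple of \<open>\<bar>x\<bar> powr (- \<nu> - 1)\<close>, which is integrable there.
  Finiteness gives access to monotonicity, limits and continuity of \<open>cdf\<close>.\<close>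

lemma finite_borel_measure_student_t:
  assumes "\<nu> > 0"
  shows "finite_borel_measure (student_t \<nu>)"
proof -
  define c where "c = Gamma ((\<nu> + 1) / 2) / (sqrt (\<nu> * pi) * Gamma (\<nu> / 2))"
  define f where "f x = (1 + x\<^sup>2 / \<nu>) powr (- (\<nu> + 1) / 2)" for x
  have [measurable]: "f \<in> borel_measurable borel" unfolding f_def by measurable
  have f_le_1: "f x \<le> 1" for x
  proof -
    have "f x \<le> 1 powr (- (\<nu> + 1) / 2)"
      unfolding f_def using assms by (intro powr_mono2') auto
    then show ?thesis by simp
  qed
  have f_tail: "f x \<le> (1 / \<nu>) powr (- (\<nu> + 1) / 2) * \<bar>x\<bar> powr (- \<nu> - 1)" if "1 \<le> \<bar>x\<bar>" for x
  proof -
    have "f x \<le> (x\<^sup>2 / \<nu>) powr (- (\<nu> + 1) / 2)"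
      unfolding f_def using assms that by (intro powr_mono2') auto
    also have "\<dots> = (1 / \<nu>) powr (- (\<nu> + 1) / 2) * (\<bar>x\<bar> powr 2) powr (- (\<nu> + 1) / 2)"
      using that assms by (subst powr_mult[symmetric]) auto
    also have "(\<bar>x\<bar> powr 2) powr (- (\<nu> + 1) / 2) = \<bar>x\<bar> powr (- \<nu> - 1)"
    proof -
      have "2 * (- (\<nu> + 1) / 2) = - \<nu> - 1" by simp
      then show ?thesis by (simp only: powr_powr)
    qed
    finally show ?thesis .
  qed
  have f_even: "f (- x) = f x" for x by (simp add: f_def)
  let ?k = "(1 / \<nu>) powr (- (\<nu> + 1) / 2)"
  let ?h = "\<lambda>x. ennreal (x powr (- \<nu> - 1)) * indicator {1..} x"
  have half: "(\<integral>\<^sup>+x. ennreal (f x) * indicator {0..} x \<partial>lborel) < \<infinity>"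
  proof -
    have "(\<integral>\<^sup>+x. ennreal (f x) * indicator {0..} x \<partial>lborel)
        \<le> (\<integral>\<^sup>+x. indicator {0..<1} x + ennreal ?k * ?h x \<partial>lborel)"
    proof (intro nn_integral_mono)
      fix x :: real
      show "ennreal (f x) * indicator {0..} x \<le> indicator {0..<1} x + ennreal ?k * ?h x"
        using f_le_1[of x] f_tail[of x]
        by (cases "x < 0"; cases "x < 1")
           (auto simp: ennreal_leI simp flip: ennreal_mult' split: split_indicator
             intro: order_trans[OF _ le_add_same_cancel2[THEN iffD2]])
    qed
    also have "\<dots> = emeasure lborel {0..<1::real} + ennreal ?k * (\<integral>\<^sup>+x. ?h x \<partial>lborel)"
      by (simp add: nn_integral_add nn_integral_cmult)
    also have "\<dots> < \<infinity>"
      using nn_integral_powr_neg_finite[OF assms] by (simp add: ennreal_mult_less_top)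
    finally show ?thesis .
  qed
  have other_half: "(\<integral>\<^sup>+x. ennreal (f x) * indicator {..0} x \<partial>lborel)
      = (\<integral>\<^sup>+x. ennreal (f x) * indicator {0..} x \<partial>lborel)"
    by (subst nn_integral_real_affine[of _ "-1" 0])
       (auto simp: f_even intro!: nn_integral_cong split: split_indicator)
  have "(\<integral>\<^sup>+x. ennreal (f x) \<partial>lborel)
      \<le> (\<integral>\<^sup>+x. ennreal (f x) * indicator {..0} x + ennreal (f x) * indicator {0..} x \<partial>lborel)"
    by (intro nn_integral_mono) (auto split: split_indicator)
  also have "\<dots> < \<infinity>"
    using half other_half by (simp add: nn_integral_add)
  finally have fin: "(\<integral>\<^sup>+x. ennreal (f x) \<partial>lborel) < \<infinity>" .
  have eq: "student_t \<nu> = density lborel (\<lambda>x. ennreal c * ennreal (f x))"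
    unfolding student_t_def f_def c_def by (simp add: ennreal_mult''[symmetric])
  have "emeasure (student_t \<nu>) (space (student_t \<nu>)) \<noteq> \<infinity>"
    unfolding eq using fin by (simp add: emeasure_density nn_integral_cmult ennreal_mult_eq_top_iff)
  then show ?thesis
    by (intro finite_borel_measure.intro finite_measureI finite_borel_measure_axioms.intro)
       (auto simp: student_t_def)
qed

lemma measure_student_t_pos:
  assumes "\<nu> > 0" and "x < y"
  shows "0 < measure (student_t \<nu>) {x<..y}"
proof -
  interpret finite_borel_measure "student_t \<nu>"
    using \<open>\<nu> > 0\<close> by (rule finite_borel_measure_student_t)
  define f where "f x = Gamma ((\<nu> + 1) / 2) / (sqrt (\<nu> * pi) * Gamma (\<nu> / 2))
      * (1 + x\<^sup>2 / \<nu>) powr (- (\<nu> + 1) / 2)" for x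
  have [measurable]: "f \<in> borel_measurable borel" unfolding f_def by measurable
  have f: "student_t \<nu> = density lborel (\<lambda>x. ennreal (f x))"
    unfolding student_t_def f_def ..
  have pos: "0 < f x" for x
  proof -
    have "0 < Gamma ((\<nu> + 1) / 2) / (sqrt (\<nu> * pi) * Gamma (\<nu> / 2))"
      using \<open>\<nu> > 0\<close> by (intro divide_pos_pos mult_pos_pos Gamma_real_pos) auto
    moreover have "0 < 1 + x\<^sup>2 / \<nu>" using \<open>\<nu> > 0\<close> by (intro add_pos_nonneg) auto
    ultimately show ?thesis unfolding f_def by (intro mult_pos_pos) auto
  qed
  have "emeasure (student_t \<nu>) {x<..y} \<noteq> 0"
  proof
    assume "emeasure (student_t \<nu>) {x<..y} = 0"
    then have "{x<..y} \<in> null_sets (student_t \<nu>)"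
      by (intro null_setsI) (auto simp: student_t_def)
    then have "AE z in lborel. z \<notin> {x<..y}"
      using pos by (auto simp: f null_sets_density_iff ennreal_eq_0_iff pos[THEN not_le[THEN iffD2]])
    then have "emeasure lborel {x<..y} = 0"
      by (intro AE_iff_measurable[THEN iffD1, rotated 2]) auto
    with \<open>x < y\<close> show False by simp
  qed
  then show ?thesis by (simp add: emeasure_eq_measure zero_less_measure_iff)
qed

lemma student_t_cdf_strict_mono:
  assumes "\<nu> > 0" and "x < y"
  shows "cdf (student_t \<nu>) x < cdf (student_t \<nu>) y"
  using finite_borel_measure.cdf_diff_eq[OF finite_borel_measure_student_t, of \<nu> x y]
    measure_student_t_pos[of \<nu> x y] assms by simp

lemma student_t_cdf_pos:
  assumes "\<nu> > 0"
  shows "0 < cdf (student_t \<nu>) x"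
  using student_t_cdf_strict_mono[OF assms, of "x - 1" x]
    finite_borel_measure.cdf_nonneg[OF finite_borel_measure_student_t[OF assms], of "x - 1"] by simp

lemma student_t_cdf_less_iff:
  assumes "\<nu> > 0"
  shows "cdf (student_t \<nu>) x < cdf (student_t \<nu>) y \<longleftrightarrow> x < y"
  using student_t_cdf_strict_mono[OF assms] by (metis less_asym linorder_neqE)

text \<open>By strict monotonicity the set in the infimum is exactly \<open>{x..}\<close>.\<close>

lemma quantile_student_t_cdf:
  assumes "\<nu> > 0"
  shows "quantile (student_t \<nu>) (cdf (student_t \<nu>) x) = ereal x"
proof -
  have "{y. cdf (student_t \<nu>) x \<le> cdf (student_t \<nu>) y} = {x..}"
    using student_t_cdf_less_iff[OF assms] by (auto simp: not_less[symmetric])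
  then show ?thesis
    unfolding quantile_def by (intro antisym Inf_lower Inf_greatest) auto
qed

text \<open>The distribution function tends to 0 at minus infinity and is continuous, so the
  intermediate value theorem applies to the left of \<open>t\<close>.\<close>

lemma student_t_cdf_surj_lower:
  assumes "\<nu> > 0" and "0 < p" and "p \<le> cdf (student_t \<nu>) t"
  obtains x where "x \<le> t" and "cdf (student_t \<nu>) x = p"
proof -
  interpret finite_borel_measure "student_t \<nu>"
    using \<open>\<nu> > 0\<close> by (rule finite_borel_measure_student_t)
  have "eventually (\<lambda>x. cdf (student_t \<nu>) x < p \<and> x \<le> t) at_bot"
    using order_tendstoD(2)[OF cdf_lim_at_bot \<open>0 < p\<close>] eventually_le_at_bot
    by (rule eventually_conj)
  then obtain s where s: "cdf (student_t \<nu>) s < p" "s \<le> t"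
    by (auto simp: eventually_at_bot_linorder)
  \<comment> \<open>A measure with a Lebesgue density has no atoms, hence a continuous distribution
    function.\<close>
  have "emeasure (student_t \<nu>) {x} = 0" for x
  proof -
    have "absolutely_continuous lborel (student_t \<nu>)"
      unfolding student_t_def by (intro absolutely_continuousI_density) measurable
    then have "{x} \<in> null_sets (student_t \<nu>)"
      unfolding absolutely_continuous_def using finite_imp_null_set_lborel[of "{x}"] by auto
    then show ?thesis by auto
  qed
  then have "isCont (cdf (student_t \<nu>)) x" for x
    by (simp add: isCont_cdf measure_def)
  then obtain x where "s \<le> x" "x \<le> t" "cdf (student_t \<nu>) x = p"
    using IVT[of "cdf (student_t \<nu>)" s p t] s assms(3) by auto
  then show ?thesis using that by blast
qed

text \<open>For \<open>z \<le> - a\<close> one has \<open>a\<^sup>2 \<le> z\<^sup>2\<close>, so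
  \<open>student_kernel_scale_le\<close> applies with \<open>k = 1 + \<nu> / a\<^sup>2\<close>. This
  \<open>k\<close> tends to 1 as \<open>a\<close> grows, so the bound is asymptotically
  sharp.\<close>

lemma student_t_cdf_tail:
  assumes "\<nu> > 0" and "0 < a" and "a \<le> b"
  shows "cdf (student_t \<nu>) (- b)
    \<le> (1 + \<nu> / a\<^sup>2) powr ((\<nu> + 1) / 2) * (b / a) powr - \<nu> * cdf (student_t \<nu>) (- a)"
proof -
  interpret finite_borel_measure "student_t \<nu>"
    using \<open>\<nu> > 0\<close> by (rule finite_borel_measure_student_t)
  have k: "0 < 1 + \<nu> / a\<^sup>2" using assms by (intro add_pos_nonneg) auto
  have "z / (b / a) \<le> - a \<longleftrightarrow> z \<le> - b" for z
  proof -
    have "z / (b / a) \<le> - a \<longleftrightarrow> a * z \<le> a * - b" 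
      using \<open>0 < a\<close> \<open>a \<le> b\<close> by (simp add: field_simps)
    then show ?thesis using \<open>0 < a\<close> by (simp only: mult_le_cancel_left_pos)
  qed
  then have S: "{z. z /\<^sub>R (b / a) \<in> {..- a}} = {..- b}"
    by (auto simp: divide_inverse_commute)
  have far: "1 + z\<^sup>2 / \<nu> \<le> (1 + \<nu> / a\<^sup>2) * (z\<^sup>2 / \<nu>)" if "z \<in> {..- a}" for z
  proof -
    have "a \<le> - z" using that by simp
    then have "a\<^sup>2 \<le> z\<^sup>2" using \<open>0 < a\<close> by (metis less_imp_le power_mono power2_minus)
    then show ?thesis using assms by (simp add: field_simps)
  qed
  have "emeasure (student_t \<nu>) {..- b}
      \<le> ennreal ((1 + \<nu> / a\<^sup>2) powr ((\<nu> + 1) / 2) * (b / a) powr - \<nu>) * emeasure (student_t \<nu>) {..- a}"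
    using student_kernel_scale_le[of power2 "{..- a}" \<nu> "b / a" "1 + \<nu> / a\<^sup>2"] far k assms
    unfolding S by (simp add: student_t_eq_kernel power_mult_distrib)
  then show ?thesis
    by (simp add: emeasure_eq_measure cdf_def flip: ennreal_mult)
qed

section \<open>Asymptotics of the copula on the diagonal\<close>

text \<open>This transfers a vanishing relative error in the level to the copula, whose values
  themselves tend to 0, so mere continuity would not suffice.\<close>

lemma diagonal_copula_asymp_equiv:
  fixes \<Sigma> :: "real ^ 'n ^ 'n" and p q :: "'b \<Rightarrow> real"
  assumes \<Sigma>: "positive_definite_correlation_matrix \<Sigma>" and "\<nu> > 0"
    and le: "\<forall>\<^sub>F s in A. 0 < p s \<and> p s \<le> q s"
    and q: "(q \<longlongrightarrow> 0) A" and ratio: "((\<lambda>s. p s / q s) \<longlongrightarrow> 1) A"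
  shows "(\<lambda>s. student_t_copula \<nu> \<Sigma> (\<lambda>_. p s)) \<sim>[A] (\<lambda>s. student_t_copula \<nu> \<Sigma> (\<lambda>_. q s))"
proof -
  define G where "G = cdf (student_t \<nu>)"
  \<comment> \<open>\<open>real_of_ereal\<close> sends infinite quantiles to 0; \<open>a_ev\<close>
    shows that eventually the quantile is finite and \<open>a\<close> has its intended
    meaning.\<close>
  define a where "a s = - real_of_ereal (quantile (student_t \<nu>) (q s))" for s
  have G_quantile: "quantile (student_t \<nu>) (G x) = ereal x" for x
    unfolding G_def using \<open>\<nu> > 0\<close> by (rule quantile_student_t_cdf)
  \<comment> \<open>As \<open>G (- Z)\<close> is positive and \<open>q\<close> tends to 0, the level
    \<open>q s\<close> is eventually attained to the left of \<open>- Z\<close>.\<close>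
  have a_ev: "\<forall>\<^sub>F s in A. Z \<le> a s \<and> q s = G (- a s)" for Z
  proof -
    have "\<forall>\<^sub>F s in A. q s < G (- Z)"
      using order_tendstoD(2)[OF q] student_t_cdf_pos[OF \<open>\<nu> > 0\<close>] unfolding G_def by blast
    then show ?thesis using le
    proof eventually_elim
      case (elim s)
      then have "0 < q s" "q s \<le> G (- Z)" by auto
      then obtain x where "x \<le> - Z" "G x = q s"
        using student_t_cdf_surj_lower[OF \<open>\<nu> > 0\<close>] unfolding G_def by metis
      then show ?case unfolding a_def by (metis G_quantile le_minus_iff minus_minus real_of_ereal.simps(1))
    qed
  qed
  then have a: "filterlim a at_top A"
    by (simp add: filterlim_at_top eventually_conj_iff)
  \<comment> \<open>This is the lower bound for \<open>(b / a s) powr - \<nu>\<close> obtained by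
    solving the inequality of \<open>student_t_cdf_tail\<close>, with \<open>p s = G (- b)\<close>
    and \<open>q s = G (- a s)\<close>, for that factor.\<close>
  define w where "w s = p s / q s * (1 + \<nu> / (a s)\<^sup>2) powr (- (\<nu> + 1) / 2)" for s
  have "((\<lambda>s. \<nu> / (a s)\<^sup>2) \<longlongrightarrow> 0) A"
    by (intro real_tendsto_divide_at_top[OF tendsto_const] filterlim_pow_at_top a) auto
  then have "((\<lambda>s. (1 + \<nu> / (a s)\<^sup>2) powr (- (\<nu> + 1) / 2)) \<longlongrightarrow> (1 + 0) powr (- (\<nu> + 1) / 2)) A"
    by (intro tendsto_intros) auto
  then have "(w \<longlongrightarrow> 1 * (1 + 0) powr (- (\<nu> + 1) / 2)) A"
    unfolding w_def by (intro tendsto_mult ratio)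
  then have w: "(w \<longlongrightarrow> 1) A" by simp
  have "\<forall>\<^sub>F s in A. student_t_copula \<nu> \<Sigma> (\<lambda>_. p s) \<in>
      {w s * student_t_copula \<nu> \<Sigma> (\<lambda>_. q s) .. student_t_copula \<nu> \<Sigma> (\<lambda>_. q s)}"
    using a_ev[of 1] le
  proof eventually_elim
    case (elim s)
    then have "1 \<le> a s" "q s = G (- a s)" "0 < p s" "p s \<le> q s" by auto
    \<comment> \<open>Since \<open>p s \<le> q s\<close>, its quantile point lies to the left of
      \<open>- a s\<close>; hence \<open>a s \<le> b\<close>, and the dilation ratio is at least
      1.\<close>
    then obtain x where "x \<le> - a s" "G x = p s"
      using student_t_cdf_surj_lower[OF \<open>\<nu> > 0\<close>] unfolding G_def by metis
    then obtain b where b: "a s \<le> b" "p s = G (- b)" by (metis le_minus_iff minus_minus)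
    have bnds: "(b / a s) powr - \<nu> * diagonal_cdf \<nu> \<Sigma> (- a s) \<le> diagonal_cdf \<nu> \<Sigma> (- b)"
        "diagonal_cdf \<nu> \<Sigma> (- b) \<le> diagonal_cdf \<nu> \<Sigma> (- a s)"
      using diagonal_cdf_bounds[OF \<Sigma> \<open>\<nu> > 0\<close>, of "a s" b] \<open>1 \<le> a s\<close> b by auto
    have D: "student_t_copula \<nu> \<Sigma> (\<lambda>_. G (- t)) = diagonal_cdf \<nu> \<Sigma> (- t)" for t
      by (simp add: student_t_copula_def diagonal_cdf_def G_quantile)
    define k where "k = (1 + \<nu> / (a s)\<^sup>2) powr ((\<nu> + 1) / 2)"
    have "0 < 1 + \<nu> / (a s)\<^sup>2" using \<open>\<nu> > 0\<close> by (intro add_pos_nonneg) auto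
    then have "0 < k" by (simp add: k_def)
    have "p s \<le> k * (b / a s) powr - \<nu> * q s"
      using student_t_cdf_tail[OF \<open>\<nu> > 0\<close>, of "a s" b] \<open>1 \<le> a s\<close> b \<open>q s = G (- a s)\<close>
      by (simp add: G_def k_def)
    moreover have "w s = p s / (k * q s)"
      unfolding w_def k_def minus_divide_left[symmetric] powr_minus by (simp add: divide_simps)
    ultimately have "w s \<le> (b / a s) powr - \<nu>"
      using \<open>0 < k\<close> \<open>0 < p s\<close> \<open>p s \<le> q s\<close> by (simp add: pos_divide_le_eq mult_ac)
    then have "w s * diagonal_cdf \<nu> \<Sigma> (- a s) \<le> (b / a s) powr - \<nu> * diagonal_cdf \<nu> \<Sigma> (- a s)"
      by (rule mult_right_mono) (simp add: diagonal_cdf_def multivariate_student_t_cdf_def)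
    then show ?case using bnds unfolding \<open>q s = G (- a s)\<close> b(2) D by simp
  qed
  moreover have "(\<lambda>s. w s * student_t_copula \<nu> \<Sigma> (\<lambda>_. q s)) \<sim>[A] (\<lambda>s. 1 * student_t_copula \<nu> \<Sigma> (\<lambda>_. q s))"
    by (intro asymp_equiv_mult tendsto_imp_asymp_equiv_const w) auto
  ultimately show ?thesis
    using asymp_equiv_sandwich_real[OF _ asymp_equiv_refl] by simp
qed

section \<open>The outage event and its probability at high SNR\<close>

text \<open>Clearing the positive denominator leaves an inequality linear in \<open>x\<close>. Its
  coefficient is positive exactly because \<open>th\<close> stays below the saturation level of the
  ratio.\<close>

lemma sinr_gt_iff:
  fixes P B A x th :: real
  assumes "0 < P" and "0 \<le> A" and "0 < x" and "0 < B - A * th"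
  shows "th < P * B * x / (P * A * x + 1) \<longleftrightarrow> th / (P * (B - A * th)) < x"
proof -
  have "0 < P * A * x + 1" using assms by (intro add_nonneg_pos) auto
  then have "th < P * B * x / (P * A * x + 1) \<longleftrightarrow> th * (P * A * x + 1) < P * B * x"
    by (rule pos_less_divide_eq)
  also have "\<dots> \<longleftrightarrow> th < x * (P * (B - A * th))"
    by (simp add: algebra_simps)
  also have "\<dots> \<longleftrightarrow> th / (P * (B - A * th)) < x"
    using assms by (intro pos_divide_less_eq[symmetric]) auto
  finally show ?thesis .
qed

text \<open>The density vanishes on \<open>{..0}\<close>. This supplies the positive gain that
  \<open>sinr_gt_iff\<close> assumes.\<close>

lemma distributed_gamma_AE_pos:
  assumes X: "distributed M lborel X (\<lambda>x. ennreal (gamma_density m gbar x))"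
  shows "AE \<omega> in M. 0 < X \<omega>"
proof -
  have [measurable]: "X \<in> borel_measurable M"
    using distributed_measurable[OF X] by simp
  have "emeasure M (X -` {..0} \<inter> space M)
      = (\<integral>\<^sup>+x. ennreal (gamma_density m gbar x) * indicator {..0} x \<partial>lborel)"
    by (rule distributed_emeasure[OF X]) simp
  also have "\<dots> = (\<integral>\<^sup>+x. 0 \<partial>(lborel :: real measure))"
    by (intro nn_integral_cong) (auto simp: gamma_density_def split: split_indicator)
  finally have "emeasure M (X -` {..0} \<inter> space M) = 0" by simp
  then show ?thesis
    by (intro AE_I[where N="X -` {..0} \<inter> space M"]) auto
qed

text \<open>Dividing both gamma bounds by the leading term squeezes the ratio between
  \<open>exp (- m * x s / gbar)\<close> and 1.\<close>

lemma gamma_cdf_ratio_tendsto: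
  assumes "0 < m" and "0 < gbar" and "prob_space M"
    and X: "distributed M lborel X (\<lambda>x. ennreal (gamma_density m gbar x))"
    and x: "(x \<longlongrightarrow> 0) A" "\<forall>\<^sub>F s in A. 0 < x s"
  shows "((\<lambda>s. cdf (distr M borel X) (x s) / (1 / (m * Gamma m) * (m * x s / gbar) powr m)) \<longlongrightarrow> 1) A"
proof (rule tendsto_sandwich)
  have pos: "0 < 1 / (m * Gamma m) * (m * t / gbar) powr m" if "0 < t" for t
    using that assms Gamma_real_pos[of m] by simp
  show "\<forall>\<^sub>F s in A. exp (- m * x s / gbar)
      \<le> cdf (distr M borel X) (x s) / (1 / (m * Gamma m) * (m * x s / gbar) powr m)"
    using x(2)
  proof eventually_elim
    case (elim s)
    then show ?case
      using gamma_cdf_bounds(1)[OF assms(1,2) elim assms(3) X] pos[OF elim]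
      by (subst pos_le_divide_eq) auto
  qed
  show "\<forall>\<^sub>F s in A. cdf (distr M borel X) (x s) / (1 / (m * Gamma m) * (m * x s / gbar) powr m) \<le> 1"
    using x(2)
  proof eventually_elim
    case (elim s)
    then show ?case
      using gamma_cdf_bounds(2)[OF assms(1,2) elim assms(3) X] pos[OF elim]
      by (subst pos_divide_le_eq) auto
  qed
  have "((\<lambda>s. exp (- m * x s / gbar)) \<longlongrightarrow> exp (- m * 0 / gbar)) A"
    using assms(2) by (intro tendsto_intros x) auto
  then show "((\<lambda>s. exp (- m * x s / gbar)) \<longlongrightarrow> 1) A" by simp
qed simp

theorem corollary1:
  fixes M :: "'a measure"
    and u :: user
    and g :: "'n::finite \<Rightarrow> 'a \<Rightarrow> real"
    and \<Sigma> :: "real ^ 'n ^ 'n"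
    and K :: nat
    and \<nu> \<kappa> \<beta> a\<^sub>b a\<^sub>u m gbar L \<alpha>\<^sub>c th\<^sub>c th\<^sub>p :: real
    and \<alpha>\<^sub>p :: "user \<Rightarrow> real"
    and g_fas :: "'a \<Rightarrow> real"
    and outage gth v outage_asymp :: "real \<Rightarrow> real"
  assumes "prob_space M"
    and "K \<ge> 1" and "\<kappa> > 0"
    and "\<beta> \<in> {0<..1}" and "a\<^sub>b \<in> {0<..1}" and "a\<^sub>u \<in> {0<..1}"
    and m_def: "m = gain_shape K \<kappa> a\<^sub>b a\<^sub>u"
    and gbar_def: "gbar = mean_gain \<beta> \<kappa> a\<^sub>b a\<^sub>u"
    and "\<nu> > 0" and "positive_definite_correlation_matrix \<Sigma>"
    and "\<And>n. distributed M lborel (g n) (\<lambda>x. ennreal (gamma_density m gbar x))"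
    and "has_copula M g (student_t_copula \<nu> \<Sigma>)"
    and "L > 0" and "\<alpha>\<^sub>c > 0" and "\<alpha>\<^sub>p User_r > 0" and "\<alpha>\<^sub>p User_t > 0"
    and "\<alpha>\<^sub>c + \<alpha>\<^sub>p User_r + \<alpha>\<^sub>p User_t = 1"
    and "th\<^sub>c > 0" and "th\<^sub>c < \<alpha>\<^sub>c / (1 - \<alpha>\<^sub>c)"
    and "th\<^sub>p > 0" and "th\<^sub>p < \<alpha>\<^sub>p u / (1 - \<alpha>\<^sub>c - \<alpha>\<^sub>p u)"
    and g_fas_def: "\<And>\<omega>. g_fas \<omega> = Max (range (\<lambda>n. g n \<omega>))"
    and outage_def: "\<And>s. outage s = 1 - measure M {\<omega> \<in> space M.
      sinr_c \<alpha>\<^sub>c \<alpha>\<^sub>p L K s (g_fas \<omega>) > th\<^sub>c \<and> sinr_p \<alpha>\<^sub>p u L K s (g_fas \<omega>) > th\<^sub>p}"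
    and gth_def: "\<And>s. gth s =
      max (threshold_c \<alpha>\<^sub>c \<alpha>\<^sub>p L K th\<^sub>c s) (threshold_p \<alpha>\<^sub>p u L K th\<^sub>p s)"
    and v_def: "\<And>s. v s = 1 / (m * Gamma m) * (m * gth s / gbar) powr m"
    and outage_asymp_def: "\<And>s. outage_asymp s =
      multivariate_student_t_cdf \<nu> \<Sigma> (\<lambda>n. quantile (student_t \<nu>) (v s))"
  shows "(\<forall>\<^sub>F s in at_top. v s \<in> {0<..<1}) \<and> outage \<sim>[at_top] outage_asymp"
proof -
  interpret prob_space M by fact
  have m: "0 < m" unfolding m_def using assms by (intro gain_shape_pos)
  have gbar: "0 < gbar" unfolding gbar_def using assms by (intro mean_gain_pos)
  have g_meas [measurable]: "g n \<in> borel_measurable M" for n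
    using distributed_measurable[OF assms(11)] by simp
  \<comment> \<open>An arbitrary port serves as representative, since all ports have the same
    density.\<close>
  define F where "F = cdf (distr M borel (g undefined))"
  have F: "cdf (distr M borel (g n)) = F" for n
  proof -
    have "distr M borel (g i) = density lborel (\<lambda>x. ennreal (gamma_density m gbar x))" for i
      using distributed_distr_eq_density[OF assms(11)] distr_cong[of M M borel lborel "g i" "g i"] by simp
    then show ?thesis by (simp add: F_def)
  qed
  have K: "0 < L * (real K)\<^sup>2" using assms by simp
  \<comment> \<open>The power factors sum to 1, so the denominators in the threshold bounds are the
    interference powers. The bounds therefore say that \<open>dc\<close> and \<open>dp\<close>
    hold.\<close>
  have dc: "0 < \<alpha>\<^sub>c - (\<alpha>\<^sub>p User_r + \<alpha>\<^sub>p User_t) * th\<^sub>c"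
  proof -
    have "1 - \<alpha>\<^sub>c = \<alpha>\<^sub>p User_r + \<alpha>\<^sub>p User_t" using assms by linarith
    then show ?thesis using assms(15,16,19) by (simp add: pos_less_divide_eq mult.commute)
  qed
  have \<alpha>_pos: "0 < \<alpha>\<^sub>p w" for w using assms by (cases w) auto
  have dp: "0 < \<alpha>\<^sub>p u - \<alpha>\<^sub>p (other_user u) * th\<^sub>p"
  proof -
    have "1 - \<alpha>\<^sub>c - \<alpha>\<^sub>p u = \<alpha>\<^sub>p (other_user u)" using assms(17) by (cases u) auto
    then show ?thesis using \<alpha>_pos assms(21) by (simp add: pos_less_divide_eq mult.commute)
  qed
  have gth_pos: "0 < gth s" if "0 < s" for s
  proof -
    have "0 < threshold_c \<alpha>\<^sub>c \<alpha>\<^sub>p L K th\<^sub>c s"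
      unfolding threshold_c_def using that assms dc by (intro divide_pos_pos mult_pos_pos) auto
    then show ?thesis unfolding gth_def by simp
  qed
  have gth_ev: "\<forall>\<^sub>F s in at_top. 0 < gth s"
    using eventually_gt_at_top[of 0] by eventually_elim (rule gth_pos)
  have gth_lim: "(gth \<longlongrightarrow> 0) at_top"
  proof -
    have lim: "((\<lambda>s::real. c / (s * L * (real K)\<^sup>2 * d)) \<longlongrightarrow> 0) at_top" for c d
      using tendsto_mult_right_zero[OF tendsto_inverse_0_at_top[OF filterlim_ident],
          of "c / (L * (real K)\<^sup>2 * d)"] by (simp add: field_simps)
    show ?thesis
      unfolding gth_def threshold_c_def threshold_p_def
      using tendsto_max[OF lim lim] by simp
  qed
  have v_ev: "\<forall>\<^sub>F s in at_top. 0 < v s"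
    using gth_ev by eventually_elim (use m gbar Gamma_real_pos[of m] in \<open>simp add: v_def\<close>)
  have v_lim: "(v \<longlongrightarrow> 0) at_top"
  proof -
    have "((\<lambda>s. m * gth s / gbar) \<longlongrightarrow> m * 0 / gbar) at_top"
      using gbar by (intro tendsto_intros gth_lim) auto
    then have "((\<lambda>s. m * gth s / gbar) \<longlongrightarrow> 0) at_top" by simp
    \<comment> \<open>The base tends to 0, so the limit of the power rests on a nonnegative base and
      the positive exponent \<open>m\<close>.\<close>
    moreover have "\<forall>\<^sub>F s in at_top. 0 \<le> m * gth s / gbar"
      using gth_ev by eventually_elim (use m gbar in simp)
    ultimately have "((\<lambda>s. (m * gth s / gbar) powr m) \<longlongrightarrow> 0 powr m) at_top"
      using m by (intro tendsto_powr' tendsto_const) auto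
    then have "((\<lambda>s. 1 / (m * Gamma m) * (m * gth s / gbar) powr m) \<longlongrightarrow> 1 / (m * Gamma m) * 0) at_top"
      by (intro tendsto_mult tendsto_const) simp
    then show ?thesis by (simp add: v_def[abs_def])
  qed
  have "outage s = student_t_copula \<nu> \<Sigma> (\<lambda>_. F (gth s))" if "0 < s" for s
  proof -
    let ?A = "{\<omega> \<in> space M. sinr_c \<alpha>\<^sub>c \<alpha>\<^sub>p L K s (g_fas \<omega>) > th\<^sub>c \<and> sinr_p \<alpha>\<^sub>p u L K s (g_fas \<omega>) > th\<^sub>p}"
    let ?B = "{\<omega> \<in> space M. \<forall>n. g n \<omega> \<le> gth s}"
    have [measurable]: "g_fas \<in> borel_measurable M"
      unfolding g_fas_def by measurable
    have P: "0 < s * L * (real K)\<^sup>2" using K that by (simp add: mult.assoc)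
    have sinr: "(sinr_c \<alpha>\<^sub>c \<alpha>\<^sub>p L K s x > th\<^sub>c \<and> sinr_p \<alpha>\<^sub>p u L K s x > th\<^sub>p) \<longleftrightarrow> gth s < x"
      if "0 < x" for x
    proof -
      have "th\<^sub>c < sinr_c \<alpha>\<^sub>c \<alpha>\<^sub>p L K s x \<longleftrightarrow> threshold_c \<alpha>\<^sub>c \<alpha>\<^sub>p L K th\<^sub>c s < x"
        using sinr_gt_iff[OF P _ that dc] \<alpha>_pos[of User_r] \<alpha>_pos[of User_t]
        by (simp add: sinr_c_def threshold_c_def mult_ac)
      moreover have "th\<^sub>p < sinr_p \<alpha>\<^sub>p u L K s x \<longleftrightarrow> threshold_p \<alpha>\<^sub>p u L K th\<^sub>p s < x"
        using sinr_gt_iff[OF P _ that dp] \<alpha>_pos[of "other_user u"]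
        by (simp add: sinr_p_def threshold_p_def mult_ac)
      ultimately show ?thesis by (simp add: gth_def)
    qed
    \<comment> \<open>The equivalence \<open>sinr\<close> holds for positive gains, so the success
      event \<open>?A\<close> is the complement of \<open>?B\<close> up to a null set.\<close>
    have "AE \<omega> in M. \<forall>n. 0 < g n \<omega>"
      using distributed_gamma_AE_pos[OF assms(11)] by (simp add: AE_all_countable)
    then have "AE \<omega> in M. \<omega> \<in> ?A \<longleftrightarrow> \<omega> \<in> space M - ?B"
    proof eventually_elim
      case (elim \<omega>)
      have "0 < g_fas \<omega>" using elim by (auto simp: g_fas_def Max_gr_iff)
      moreover have "gth s < g_fas \<omega> \<longleftrightarrow> \<not> (\<forall>n. g n \<omega> \<le> gth s)"
        by (auto simp: g_fas_def Max_gr_iff not_le)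
      ultimately show ?case using sinr by auto
    qed
    then have "prob ?A = prob (space M - ?B)"
      by (rule finite_measure_eq_AE) (unfold sinr_c_def sinr_p_def, measurable)
    also have "\<dots> = 1 - prob ?B" by (rule prob_compl) measurable
    finally have "outage s = prob ?B" by (simp add: outage_def)
    also have "\<dots> = student_t_copula \<nu> \<Sigma> (\<lambda>_. F (gth s))"
      using assms(12) by (simp add: has_copula_def F)
    finally show ?thesis .
  qed
  then have "\<forall>\<^sub>F s in at_top. outage s = student_t_copula \<nu> \<Sigma> (\<lambda>_. F (gth s))"
    using eventually_gt_at_top[of 0] by (rule eventually_mono[rotated])
  moreover have "(\<lambda>s. student_t_copula \<nu> \<Sigma> (\<lambda>_. F (gth s))) \<sim>[at_top] (\<lambda>s. student_t_copula \<nu> \<Sigma> (\<lambda>_. v s))"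
  proof (rule diagonal_copula_asymp_equiv)
    show "\<forall>\<^sub>F s in at_top. 0 < F (gth s) \<and> F (gth s) \<le> v s"
      using gth_ev v_ev
    proof eventually_elim
      case (elim s)
      \<comment> \<open>This positive quantity is the lower gamma bound, whence
        \<open>F (gth s)\<close> is positive.\<close>
      have "0 < exp (- m * gth s / gbar) * v s" using elim by simp
      then show ?case
        using gamma_cdf_bounds[OF m gbar elim(1) assms(1) assms(11)[of undefined]]
        by (auto simp: F_def v_def)
    qed
    show "((\<lambda>s. F (gth s) / v s) \<longlongrightarrow> 1) at_top"
      unfolding F_def v_def
      by (rule gamma_cdf_ratio_tendsto[OF m gbar assms(1) assms(11) gth_lim gth_ev])
  qed (fact assms(9,10) v_lim)+
  ultimately have "outage \<sim>[at_top] (\<lambda>s. student_t_copula \<nu> \<Sigma> (\<lambda>_. v s))"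
    by (rule asymp_equiv_trans[OF asymp_equiv_refl_ev])
  moreover have "(\<lambda>s. student_t_copula \<nu> \<Sigma> (\<lambda>_. v s)) = outage_asymp"
    by (simp add: fun_eq_iff student_t_copula_def outage_asymp_def)
  moreover have "\<forall>\<^sub>F s in at_top. v s \<in> {0<..<1}"
    using v_ev order_tendstoD(2)[OF v_lim zero_less_one] by eventually_elim simp
  ultimately show ?thesis by simp
qed

end
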